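(* Let $f:\mathbb{R}^d\to\mathbb{R}\cup\{\infty\}$ be $\ell$-smooth. Fix $x\in\mathcal{X}$. Then the quantity $$f(x)+\langle\nabla f(x),y-x\rangle+\int_0^{\|y-x\|}q^{-1}(\tau;\|\nabla f(x)\|)\,d\tau,$$ viewed as a function of $y\in\mathcal{X}$ with $\|y-x\|\in[0,q_{\max}(\|\nabla f(x)\|))$, is minimized at $$y^*=x-\left(\int_0^1\frac{dv}{\ell(\|\nabla f(x)\|+\|\nabla f(x)\|v)}\right)\nabla f(x)\in\mathcal{X},$$ and at $y=y^*$ it equals $$f(x)-\|\nabla f(x)\|^2\int_0^1\frac{1-v}{\ell(\|\nabla f(x)\|+\|\nabla f(x)\|v)}\,dv.$$
   Context: Norms are Euclidean for vectors and spectral for matrices. For $f:\mathbb{R}^d\to\mathbb{R}\cup\{\infty\}$ put $\mathcal{X}=\{x\in\mathbb{R}^d: f(x)<\infty\}$, assumed to be open and convex. $f$ is $\ell$-smooth if $f$ is twice differentiable on $\mathcal{X}$, $f$ is continuous on the closure of $\mathcal{X}$ (as a map into $\mathbb{R}\cup\{\infty\}$), and $\ell:[0,\infty)\to(0,\infty)$ is a non-decreasing positive locally Lipschitz function such that $\|\nabla^2f(x)\|\le\ell(\|\nabla f(x)\|)$ for all $x\in\mathcal{X}$. For $a\ge0$ define $q(s;a)=\int_0^s\frac{dv}{\ell(a+v)}$ for $s\ge0$ and $q_{\max}(a)=\int_0^\infty\frac{dv}{\ell(a+v)}\in(0,\infty]$. For fixed $a$, $q(\cdot;a)$ is a strictly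 increasing bijection $[0,\infty)\to[0,q_{\max}(a))$, and $q^{-1}(\cdot;a):[0,q_{\max}(a))\to[0,\infty)$ denotes its inverse. *)

theory Defs
  imports "HOL-Analysis.Analysis"
begin

text \<open>A function \<open>f : \<real>\<^sup>d \<rightarrow> \<real> \<union> {\<infinity>}\<close> is an \<^typ>\<open>ereal\<close>-valued function that never takes the
  value \<open>-\<infinity>\<close>; that restriction is stated as a hypothesis where such an \<open>f\<close> is used.\<close>

definition edomain :: "('a \<Rightarrow> ereal) \<Rightarrow> 'a set" where
  "edomain f = {x. f x < \<infinity>}"

text \<open>Derivatives are only meaningful at points of \<^term>\<open>edomain f\<close> (which will be open): there
  \<open>real_of_ereal \<circ> f\<close> agrees with \<open>f\<close>, while the junk value \<open>0\<close> that it takes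
  where \<open>f\<close> is infinite does not influence them.\<close>

definition grad :: "(real^'d \<Rightarrow> ereal) \<Rightarrow> real^'d \<Rightarrow> real^'d" where
  "grad f x = (THE D. GDERIV (real_of_ereal \<circ> f) x :> D)"

definition hessian :: "(real^'d \<Rightarrow> ereal) \<Rightarrow> real^'d \<Rightarrow> real^'d^'d" where
  "hessian f x = jacobian (grad f) (at x)"

definition spectral_norm :: "real^'n^'m \<Rightarrow> real" where
  "spectral_norm A = onorm ((*v) A)"

definition twice_differentiable_at :: "(real^'d \<Rightarrow> ereal) \<Rightarrow> real^'d \<Rightarrow> bool" where
  "twice_differentiable_at f x \<longleftrightarrow>
     (real_of_ereal \<circ> f) differentiable (at x) \<and> grad f differentiable (at x)"

text \<open>The function \<open>l : [0, \<infinity>) \<rightarrow> (0, \<infinity>)\<close> is total on the reals; only its values on \<open>[0, \<infinity>)\<close>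
  are constrained or used. The library notion \<^const>\<open>local_lipschitz\<close> concerns families of
  functions, and is applied to a constant family.\<close>

definition l_smooth :: "(real \<Rightarrow> real) \<Rightarrow> (real^'d \<Rightarrow> ereal) \<Rightarrow> bool" where
  "l_smooth l f \<longleftrightarrow>
     (\<forall>x\<in>edomain f. twice_differentiable_at f x) \<and>
     continuous_on (closure (edomain f)) f \<and>
     (\<forall>s\<ge>0. 0 < l s) \<and>
     mono_on {0..} l \<and>
     local_lipschitz (UNIV :: real set) {0..} (\<lambda>_. l) \<and>
     (\<forall>x\<in>edomain f. spectral_norm (hessian f x) \<le> l (norm (grad f x)))"

definition q :: "(real \<Rightarrow> real) \<Rightarrow> real \<Rightarrow> real \<Rightarrow> real" where
  "q l a s = integral {0..s} (\<lambda>v. 1 / l (a + v))"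

text \<open>\<open>q\<^sub>m\<^sub>a\<^sub>x\<close> may be infinite, so the improper integral is taken in \<^typ>\<open>ennreal\<close>.\<close>

definition q_max :: "(real \<Rightarrow> real) \<Rightarrow> real \<Rightarrow> ennreal" where
  "q_max l a = (\<integral>\<^sup>+v\<in>{0..}. ennreal (1 / l (a + v)) \<partial>lborel)"

definition q_inv :: "(real \<Rightarrow> real) \<Rightarrow> real \<Rightarrow> real \<Rightarrow> real" where
  "q_inv l a = the_inv_into {0..} (q l a)"

end

theory Submission
  imports Defs
begin

text \<open>Write \<open>a = \<parallel>\<nabla>f x\<parallel>\<close>. By the Cauchy-Schwarz inequality the quantity at a point \<open>y\<close> at distance
  \<open>r\<close> from \<open>x\<close> is at least \<open>f x - a r + \<integral>\<^sub>0\<^sup>r q\<^sup>-\<^sup>1(\<tau>; a) d\<tau>\<close>, with equality when \<open>y - x\<close> points along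
  \<open>- \<nabla>f x\<close>. Every \<open>r < q\<^sub>m\<^sub>a\<^sub>x(a)\<close> is \<open>q(s; a)\<close> for some \<open>s\<close> (\<open>less_q_max_imp_q\<close>), and the
  substitution \<open>\<tau> = q(v; a)\<close> turns the radial part of the bound into \<open>\<integral>\<^sub>0\<^sup>s (v - a) / l(a + v) dv\<close>.
  The integrand is negative before \<open>a\<close> and positive after it, so \<open>s = a\<close> is optimal
  (\<open>penalty_minimal\<close>). Rescaling the integrals over \<open>[0, a]\<close> to \<open>[0, 1]\<close> shows that \<open>y\<^sup>*\<close> is the
  point at distance \<open>q(a; a)\<close> in the direction \<open>- \<nabla>f x\<close>, and gives the stated minimal value.

  What is left is that \<open>y\<^sup>*\<close> lies in the domain, and here smoothness enters. The Hessian bound is a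
  differential inequality for the gradient norm along segments; integrating it bounds the gradient
  by \<open>a + v\<close> at all points of the domain within distance \<open>q(v; a)\<close> of \<open>x\<close> (\<open>grad_bound\<close>). Hence \<open>f\<close> is
  bounded above there. Since \<open>f\<close> is continuous up to the boundary and infinite on it, the domain
  cannot end inside that ball (\<open>cball_subset_dom\<close>).\<close>

section \<open>The function q and its inverse\<close>

locale positive_rate =
  fixes l :: "real \<Rightarrow> real" and a :: real
  assumes nonneg: "0 \<le> a"
    and cont: "continuous_on {0..} l"
    and pos: "\<And>s. 0 \<le> s \<Longrightarrow> 0 < l s"
begin

lemma continuous_on_recip: "continuous_on {0..} (\<lambda>v. 1 / l (a + v))"
proof (rule continuous_on_divide)
  show "continuous_on {0..} (\<lambda>v. l (a + v))"
    by (rule continuous_on_compose2[OF cont]) (use nonneg in \<open>auto intro!: continuous_intros\<close>)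
  show "\<forall>v\<in>{0..}. l (a + v) \<noteq> 0"
    using pos nonneg by (metis add_nonneg_nonneg atLeast_iff less_irrefl)
qed auto

lemma recip_pos: "0 \<le> v \<Longrightarrow> 0 < 1 / l (a + v)"
  using pos nonneg by simp

lemma has_integral_recip: "((\<lambda>v. 1 / l (a + v)) has_integral q l a s) {0..s}"
  unfolding q_def
  by (intro integrable_integral integrable_continuous_real
      continuous_on_subset[OF continuous_on_recip]) auto

lemma q_zero [simp]: "q l a 0 = 0"
  by (simp add: q_def)

lemma q_has_derivative_within:
  assumes "s \<in> {0..b}"
  shows "(q l a has_real_derivative 1 / l (a + s)) (at s within {0..b})"
  using integral_has_real_derivative[OF continuous_on_subset[OF continuous_on_recip] assms]
  unfolding q_def[abs_def] by auto

lemma q_has_derivative: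
  assumes "0 < s"
  shows "(q l a has_real_derivative 1 / l (a + s)) (at s)"
  using q_has_derivative_within[of s "s + 1"] assms
  by (simp add: at_within_Icc_at)

lemma continuous_on_q: "0 \<le> c \<Longrightarrow> continuous_on {c..b} (q l a)"
  by (rule continuous_on_subset[of "{0..b}"])
    (auto intro!: DERIV_continuous_on q_has_derivative_within)

lemma q_strict_mono:
  assumes "0 \<le> s" "s < t"
  shows "q l a s < q l a t"
proof (rule DERIV_pos_imp_increasing_open[where f = "q l a", OF assms(2)])
  fix u assume "s < u" "u < t"
  then show "\<exists>y. DERIV (q l a) u :> y \<and> 0 < y"
    using q_has_derivative[of u] recip_pos[of u] assms by auto
qed (use assms continuous_on_q in auto)

lemma q_mono: "0 \<le> s \<Longrightarrow> s \<le> t \<Longrightarrow> q l a s \<le> q l a t"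
  using q_strict_mono by (metis order.order_iff_strict)

lemma q_nonneg: "0 \<le> s \<Longrightarrow> 0 \<le> q l a s"
  using q_mono[of 0 s] by simp

lemma q_inv_q: "0 \<le> s \<Longrightarrow> q_inv l a (q l a s) = s"
  unfolding q_inv_def
  by (rule the_inv_into_f_f)
    (auto simp: inj_on_def, metis linorder_neqE_linordered_idom order_less_irrefl q_strict_mono)

lemma q_image: "0 \<le> s \<Longrightarrow> q l a ` {0..s} = {0..q l a s}"
proof (intro equalityI subsetI)
  fix r assume s: "0 \<le> s" and "r \<in> {0..q l a s}"
  then show "r \<in> q l a ` {0..s}"
    using IVT'[of "q l a" 0 r s] continuous_on_q[of 0 s] by auto
qed (auto intro: q_mono q_nonneg)

text \<open>A continuous injection on a compact interval has a continuous inverse.\<close>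

lemma continuous_on_q_inv:
  assumes "0 \<le> s"
  shows "continuous_on {0..q l a s} (q_inv l a)"
  using continuous_on_inv[of "{0..s}" "q l a" "q_inv l a"] continuous_on_q[of 0 s] q_inv_q
  by (simp add: q_image[OF assms])

text \<open>The substitution \<open>\<tau> = q(v; a)\<close>, under which \<open>q\<^sup>-\<^sup>1(\<tau>; a)\<close> is just \<open>v\<close>.\<close>

lemma has_integral_q_inv:
  assumes "0 \<le> s"
  shows "((\<lambda>v. v / l (a + v)) has_integral integral {0..q l a s} (q_inv l a)) {0..s}"
proof -
  have "((\<lambda>v. (1 / l (a + v)) *\<^sub>R q_inv l a (q l a v)) has_integral
      integral {q l a 0..q l a s} (q_inv l a)) {0..s}"
    by (rule has_integral_substitution[where c = 0 and d = "q l a s"])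
      (use assms q_image continuous_on_q_inv q_has_derivative_within in \<open>auto simp: q_nonneg\<close>)
  then show ?thesis
    unfolding q_zero by (rule has_integral_eq[rotated]) (auto simp: q_inv_q)

qed

text \<open>The improper integral is at least \<open>q(s + 1; a)\<close>, which already exceeds \<open>q(s; a)\<close>.\<close>

lemma q_less_q_max:
  assumes "0 \<le> s"
  shows "ennreal (q l a s) < q_max l a"
proof -
  have "ennreal (q l a s) < ennreal (q l a (s + 1))"
    using assms q_strict_mono[of s "s + 1"] q_nonneg[of s] by (simp add: ennreal_less_iff)
  also have "\<dots> = (\<integral>\<^sup>+v\<in>{0..s + 1}. ennreal (1 / l (a + v)) \<partial>lborel)"
    by (rule nn_integral_has_integral_lebesgue'[symmetric])
      (use nonneg pos in \<open>auto intro: less_imp_le has_integral_recip\<close>)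
  also have "\<dots> \<le> q_max l a"
    unfolding q_max_def by (intro nn_integral_mono) (auto simp: indicator_def)
  finally show ?thesis .
qed

lemma q_max_eq_SUP: "q_max l a = (SUP n. ennreal (q l a (real n)))"
proof -
  let ?h = "\<lambda>n v. ennreal (1 / l (a + v)) * indicator {0..real n} v"
  have "?h n \<in> borel_measurable lborel" for n
  proof -
    have "(\<lambda>v. indicator {0..real n} v *\<^sub>R (1 / l (a + v))) \<in> borel_measurable borel"
      by (intro borel_measurable_continuous_on_indicator
          continuous_on_subset[OF continuous_on_recip]) auto
    then have "(\<lambda>v. ennreal (indicator {0..real n} v *\<^sub>R (1 / l (a + v)))) \<in> borel_measurable lborel"
      by simp
    moreover have "(\<lambda>v. ennreal (indicator {0..real n} v *\<^sub>R (1 / l (a + v)))) = ?h n"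
      by (auto simp: fun_eq_iff indicator_def)
    ultimately show ?thesis by simp
  qed
  moreover have "incseq ?h"
    by (auto simp: incseq_def le_fun_def indicator_def)
  ultimately have "(\<integral>\<^sup>+v. (SUP n. ?h n v) \<partial>lborel) = (SUP n. integral\<^sup>N lborel (?h n))"
    by (intro nn_integral_monotone_convergence_SUP)
  moreover have "(SUP n. ?h n v) = ennreal (1 / l (a + v)) * indicator {0..} v" for v
  proof (rule antisym)
    show "(SUP n. ?h n v) \<le> ennreal (1 / l (a + v)) * indicator {0..} v"
      by (rule SUP_least) (auto simp: indicator_def)
    obtain n where "v \<le> real n" using real_arch_simple by blast
    then have "ennreal (1 / l (a + v)) * indicator {0..} v \<le> ?h n v"
      by (auto simp: indicator_def)
    also have "\<dots> \<le> (SUP n. ?h n v)" by (rule SUP_upper) simp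
    finally show "ennreal (1 / l (a + v)) * indicator {0..} v \<le> (SUP n. ?h n v)" .
  qed
  moreover have "integral\<^sup>N lborel (?h n) = ennreal (q l a (real n))" for n
    by (rule nn_integral_has_integral_lebesgue')
      (use nonneg pos in \<open>auto intro: less_imp_le has_integral_recip\<close>)
  ultimately show ?thesis by (simp add: q_max_def)
qed

text \<open>As the integrals over \<open>[0, n]\<close> increase to the improper one, some \<open>q(n; a)\<close> exceeds \<open>r\<close>, and
  the intermediate value theorem applies on \<open>[0, n]\<close>.\<close>

lemma less_q_max_imp_q:
  assumes "0 \<le> r" "ennreal r < q_max l a"
  obtains s where "0 \<le> s" "r = q l a s"
proof -
  obtain n where "ennreal r < ennreal (q l a (real n))"
    using assms by (auto simp: q_max_eq_SUP less_SUP_iff)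
  then have "r \<in> q l a ` {0..real n}"
    using assms(1) by (auto simp: q_image ennreal_less_iff)
  then show thesis using that by auto
qed

section \<open>The one-dimensional minimization\<close>

lemma has_integral_penalty:
  assumes "0 \<le> s"
  shows "((\<lambda>v. (v - a) / l (a + v)) has_integral
    integral {0..q l a s} (q_inv l a) - a * q l a s) {0..s}"
  using has_integral_diff[OF has_integral_q_inv[OF assms]
      has_integral_mult_right[OF has_integral_recip[of s], of a]]
  by (simp add: diff_divide_distrib)

lemma continuous_on_weight: "continuous_on {0..} (\<lambda>v. (v - a) / l (a + v))"
proof -
  have "continuous_on {0..} (\<lambda>v. (v - a) * (1 / l (a + v)))"
    by (intro continuous_on_mult continuous_on_recip continuous_on_diff continuous_on_id
        continuous_on_const)
  then show ?thesis by simp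
qed

text \<open>Both sides are integrals of \<open>(v - a) / l (a + v)\<close> from \<open>0\<close>, and this integrand changes sign
  from negative to positive exactly at \<open>a\<close>.\<close>

lemma penalty_minimal:
  assumes "0 \<le> s"
  shows "integral {0..q l a a} (q_inv l a) - a * q l a a
    \<le> integral {0..q l a s} (q_inv l a) - a * q l a s"
proof -
  let ?k = "\<lambda>v. (v - a) / l (a + v)"
  have int: "?k integrable_on {c..d}" if "0 \<le> c" for c d
    using that by (intro integrable_continuous_real continuous_on_subset[OF continuous_on_weight]) auto
  have val: "integral {0..t} ?k = integral {0..q l a t} (q_inv l a) - a * q l a t"
    if "0 \<le> t" for t
    using has_integral_penalty[OF that] by (rule integral_unique)
  have "integral {0..a} ?k \<le> integral {0..s} ?k"
  proof (cases "a \<le> s")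
    case True
    have "0 \<le> integral {a..s} ?k"
      using nonneg pos by (intro integral_nonneg int) (auto intro!: divide_nonneg_pos)
    moreover have "integral {0..a} ?k + integral {a..s} ?k = integral {0..s} ?k"
      using True nonneg by (intro Henstock_Kurzweil_Integration.integral_combine int) auto
    ultimately show ?thesis by simp
  next
    case False
    have "integral {s..a} ?k \<le> integral {s..a} (\<lambda>_. 0)"
      using nonneg assms pos
      by (intro integral_le int) (auto intro!: divide_nonpos_pos)
    moreover have "integral {0..s} ?k + integral {s..a} ?k = integral {0..a} ?k"
      using False assms by (intro Henstock_Kurzweil_Integration.integral_combine int) auto
    ultimately show ?thesis by simp
  qed
  then show ?thesis using assms nonneg by (simp add: val)
qed

lemma integral_scale:
  fixes h :: "real \<Rightarrow> real"
  assumes "continuous_on {0..a} h"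
  shows "a * integral {0..1} (\<lambda>v. h (a * v)) = integral {0..a} h"
proof -
  have "((\<lambda>v. a *\<^sub>R h (a * v)) has_integral integral {a * 0..a * 1} h) {0..1}"
    by (rule has_integral_substitution[where c = 0 and d = a])
      (use nonneg assms in \<open>auto intro!: derivative_eq_intros mult_left_le\<close>)
  from integral_unique[OF this] show ?thesis by simp
qed

text \<open>The integral on the left is the step size that multiplies \<open>- \<nabla>f x\<close> in \<open>y\<^sup>*\<close>, so this gives the
  distance from \<open>x\<close> to \<open>y\<^sup>*\<close>.\<close>

lemma q_at_a: "a * integral {0..1} (\<lambda>v. 1 / l (a + a * v)) = q l a a"
  unfolding q_def
  by (intro integral_scale continuous_on_subset[OF continuous_on_recip]) auto

lemma penalty_at_a:
  "integral {0..q l a a} (q_inv l a) - a * q l a a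
    = - (a\<^sup>2 * integral {0..1} (\<lambda>v. (1 - v) / l (a + a * v)))"
proof -
  have "continuous_on {0..a} (\<lambda>v. (v - a) / l (a + v))"
    by (rule continuous_on_subset[OF continuous_on_weight]) simp
  from integral_scale[OF this]
  have "integral {0..q l a a} (q_inv l a) - a * q l a a
      = a * integral {0..1} (\<lambda>v. (a * v - a) / l (a + a * v))"
    using integral_unique[OF has_integral_penalty[OF nonneg]] by simp
  also have "(\<lambda>v. (a * v - a) / l (a + a * v)) = (\<lambda>v. - a * ((1 - v) / l (a + a * v)))"
  proof
    fix v
    have "a * v - a = - a * (1 - v)" by (simp add: algebra_simps)
    then show "(a * v - a) / l (a + a * v) = - a * ((1 - v) / l (a + a * v))" by simp
  qed
  finally show ?thesis
    unfolding integral_mult_right by (simp add: power2_eq_square)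
qed

end

section \<open>Gradient growth and the extent of the domain\<close>

text \<open>The derivative is a linear functional, hence the inner product with a unique vector; this is
  what the definite description in \<^const>\<open>grad\<close> selects.\<close>

lemma grad_has_derivative:
  assumes "(real_of_ereal \<circ> f) differentiable (at z)"
  shows "((real_of_ereal \<circ> f) has_derivative (\<lambda>h. h \<bullet> grad f z)) (at z)"
proof -
  obtain A where A: "((real_of_ereal \<circ> f) has_derivative A) (at z)"
    using assms by (auto simp: differentiable_def)
  interpret A: bounded_linear A
    using A by (rule has_derivative_bounded_linear)
  define D where "D = adjoint A 1"
  have "A = (\<lambda>h. h \<bullet> D)"
    using adjoint_works[OF A.linear, of _ 1] by (simp add: fun_eq_iff D_def)
  with A have D: "GDERIV (real_of_ereal \<circ> f) z :> D"
    unfolding gderiv_def by simp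
  moreover have "D' = D" if "GDERIV (real_of_ereal \<circ> f) z :> D'" for D'
  proof -
    have "(\<lambda>h. h \<bullet> D') = (\<lambda>h. h \<bullet> D)"
      using that D unfolding gderiv_def by (rule has_derivative_unique)
    then have "h \<bullet> D' = h \<bullet> D" for h by (rule fun_cong)
    then show ?thesis using vector_eq_ldot[of D' D] by blast
  qed
  ultimately have "grad f z = D"
    unfolding grad_def by (intro the_equality)
  then show ?thesis using D by (simp add: gderiv_def)
qed

lemma norm_mult_le_spectral_norm: "norm (A *v u) \<le> spectral_norm A * norm u"
  unfolding spectral_norm_def by (rule onorm) simp

locale l_smooth_at =
  fixes f :: "real^'d \<Rightarrow> ereal" and l :: "real \<Rightarrow> real" and x :: "real^'d"
  assumes not_MInf: "\<And>z. f z \<noteq> -\<infinity>"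
    and open_dom: "open (edomain f)"
    and convex_dom: "convex (edomain f)"
    and smooth: "l_smooth l f"
    and x_dom: "x \<in> edomain f"
begin

sublocale positive_rate l "norm (grad f x)"
proof
  show "continuous_on {0..} l"
    using smooth unfolding l_smooth_def
    by (elim conjE) (rule local_lipschitz_continuous_on[OF _ UNIV_I])
  show "0 < l s" if "0 \<le> s" for s
    using smooth that unfolding l_smooth_def by blast
qed simp

lemma f_eq_ereal: "z \<in> edomain f \<Longrightarrow> f z = ereal (real_of_ereal (f z))"
  using not_MInf[of z] by (cases "f z") (auto simp: edomain_def)

lemma f_derivative:
  "z \<in> edomain f \<Longrightarrow> ((real_of_ereal \<circ> f) has_derivative (\<lambda>h. h \<bullet> grad f z)) (at z)"
  using smooth unfolding l_smooth_def twice_differentiable_at_def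
  by (intro grad_has_derivative) blast

lemma grad_derivative:
  "z \<in> edomain f \<Longrightarrow> (grad f has_derivative (\<lambda>h. hessian f z *v h)) (at z)"
  using smooth unfolding hessian_def l_smooth_def twice_differentiable_at_def
  by (intro iffD1[OF jacobian_works]) blast

lemma hessian_bound:
  assumes "z \<in> edomain f"
  shows "norm (hessian f z *v u) \<le> l (norm (grad f z)) * norm u"
proof (rule order.trans[OF norm_mult_le_spectral_norm])
  show "spectral_norm (hessian f z) * norm u \<le> l (norm (grad f z)) * norm u"
    using smooth assms unfolding l_smooth_def by (elim conjE) (intro mult_right_mono; simp)
qed

lemma segment_in_dom:
  assumes "y \<in> edomain f" "0 \<le> t" "t \<le> 1"
  shows "x + t *\<^sub>R (y - x) \<in> edomain f"
proof -
  have "x + t *\<^sub>R (y - x) = (1 - t) *\<^sub>R x + t *\<^sub>R y"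
    by (simp add: algebra_simps)
  then show ?thesis using convexD_alt[OF convex_dom x_dom assms] by (simp only:)
qed

text \<open>Were the bound to fail at \<open>y\<close>, consider the last parameter \<open>c\<close> on the segment from
  \<open>x\<close> to \<open>y\<close> at which the gradient has norm \<open>a = \<parallel>\<nabla>f x\<parallel>\<close>. Beyond \<open>c\<close> the norm \<open>w\<close> of the gradient
  exceeds \<open>a\<close>; so it is positive and hence differentiable, and \<open>\<parallel>\<nabla>\<^sup>2f\<parallel> \<le> l(\<parallel>\<nabla>f\<parallel>)\<close> says that
  \<open>q(w - a; a)\<close> has slope at most \<open>\<parallel>y - x\<parallel>\<close>. The mean value theorem, unlike integration of the
  slope, makes do with a Hessian that need not be continuous.\<close>

lemma grad_bound:
  assumes y: "y \<in> edomain f" and v: "0 \<le> v" and dist: "norm (y - x) \<le> q l (norm (grad f x)) v"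
  shows "norm (grad f y) \<le> norm (grad f x) + v"
proof (rule ccontr)
  define a where "a = norm (grad f x)"
  define z where "z = (\<lambda>t. x + t *\<^sub>R (y - x))"
  define w where "w = (\<lambda>t. norm (grad f (z t)))"
  assume "\<not> ?thesis"
  then have w1: "a + v < w 1" by (simp add: w_def z_def a_def)
  have w0: "w 0 = a" by (simp add: w_def z_def a_def)
  have z_dom: "z t \<in> edomain f" if "t \<in> {0..1}" for t
    using segment_in_dom[OF y] that by (auto simp: z_def)
  have grad_z: "((\<lambda>t. grad f (z t)) has_derivative (\<lambda>s. hessian f (z t) *v (s *\<^sub>R (y - x)))) (at t)"
    if "t \<in> {0..1}" for t
  proof -
    have "(z has_derivative (\<lambda>s. s *\<^sub>R (y - x))) (at t)"
      unfolding z_def by (auto intro!: derivative_eq_intros)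
    from has_derivative_compose[OF this grad_derivative[OF z_dom[OF that]]] show ?thesis .
  qed
  have cont_w: "continuous_on {0..1} w"
    unfolding w_def
    by (rule continuous_on_norm, rule has_derivative_continuous_on,
        rule has_derivative_at_withinI, erule grad_z)
  define K where "K = {t \<in> {0..1}. w t = a}"
  have "compact K"
    unfolding K_def compact_eq_bounded_closed
  proof
    show "closed {t \<in> {0..1}. w t = a}"
      using continuous_closed_preimage[OF cont_w, of "{a}"]
      by (auto simp: vimage_def Int_def)
  qed (rule bounded_subset[of "{0..1}"], auto)
  moreover have "0 \<in> K" using w0 by (simp add: K_def)
  ultimately obtain c where c: "c \<in> K" and last: "\<And>t. t \<in> K \<Longrightarrow> t \<le> c"
    by (metis compact_attains_sup empty_iff)
  have c01: "0 \<le> c" "c < 1" and wc: "w c = a"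
    using c w1 v by (auto simp: K_def order.order_iff_strict)
  have above: "a < w t" if "c < t" "t \<le> 1" for t
  proof (rule ccontr)
    assume "\<not> a < w t"
    moreover have "continuous_on {t..1} w"
      using that c01 by (intro continuous_on_subset[OF cont_w]) auto
    ultimately have "\<exists>t'\<ge>t. t' \<le> 1 \<and> w t' = a"
      using that w1 v by (intro IVT') auto
    then obtain t' where "t \<le> t'" "t' \<le> 1" "w t' = a" by blast
    then show False using last[of t'] that c01 by (auto simp: K_def)
  qed
  have cont_excess: "continuous_on {c..1} (\<lambda>t. w t - a)"
    using c01 by (intro continuous_on_diff continuous_on_const continuous_on_subset[OF cont_w]) auto
  then obtain m where m: "\<And>t. t \<in> {c..1} \<Longrightarrow> w t - a \<le> m"
    using continuous_attains_sup[OF compact_Icc, of c 1 "\<lambda>t. w t - a"] c01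
    by (metis atLeastAtMost_iff empty_iff less_imp_le order_refl)
  have q_cont: "continuous_on {c..1} (\<lambda>t. q l a (w t - a))"
  proof (rule continuous_on_compose2[OF _ cont_excess])
    show "continuous_on {0..m} (q l a)"
      unfolding a_def by (rule continuous_on_q) simp
    show "(\<lambda>t. w t - a) ` {c..1} \<subseteq> {0..m}"
      using above wc m by (force simp: order.order_iff_strict)
  qed
  have q_deriv: "((\<lambda>t. q l a (w t - a)) has_derivative
      (\<lambda>s. (1 / l (w t)) * ((hessian f (z t) *v (s *\<^sub>R (y - x))) \<bullet> sgn (grad f (z t))))) (at t)"
    if "c < t" "t < 1" for t
  proof -
    have "a < w t" using above that by simp
    then have "grad f (z t) \<noteq> 0" by (auto simp: w_def a_def)
    then have "(w has_derivative (\<lambda>s. (hessian f (z t) *v (s *\<^sub>R (y - x))) \<bullet> sgn (grad f (z t)))) (at t)"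
      unfolding w_def using that c01
      by (intro has_derivative_compose[OF grad_z has_derivative_norm]) auto
    then have "((\<lambda>t. w t - a) has_derivative
        (\<lambda>s. (hessian f (z t) *v (s *\<^sub>R (y - x))) \<bullet> sgn (grad f (z t)))) (at t)"
      by (auto intro!: derivative_eq_intros)
    moreover have "(q l a has_derivative (*) (1 / l (w t))) (at (w t - a))"
      using q_has_derivative[of "w t - a", folded a_def] \<open>a < w t\<close>
      by (simp add: has_field_derivative_def)
    ultimately show ?thesis
      using has_derivative_compose[of "\<lambda>t. w t - a" _ t UNIV "q l a" "(*) (1 / l (w t))"] by blast
  qed
  obtain \<xi> where \<xi>: "c < \<xi>" "\<xi> < 1"
    and mean: "q l a (w 1 - a) - q l a (w c - a)
      = (1 / l (w \<xi>)) * ((hessian f (z \<xi>) *v ((1 - c) *\<^sub>R (y - x))) \<bullet> sgn (grad f (z \<xi>)))"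
    using mvt[OF c01(2) q_cont q_deriv] by auto
  have "(hessian f (z \<xi>) *v ((1 - c) *\<^sub>R (y - x))) \<bullet> sgn (grad f (z \<xi>))
      \<le> norm (hessian f (z \<xi>) *v ((1 - c) *\<^sub>R (y - x))) * norm (sgn (grad f (z \<xi>)))"
    by (rule norm_cauchy_schwarz)
  also have "\<dots> \<le> norm (hessian f (z \<xi>) *v ((1 - c) *\<^sub>R (y - x)))"
    by (simp add: norm_sgn)
  also have "\<dots> \<le> l (w \<xi>) * norm ((1 - c) *\<^sub>R (y - x))"
    unfolding w_def using \<xi> c01 by (intro hessian_bound z_dom) auto
  also have "\<dots> \<le> l (w \<xi>) * norm (y - x)"
    using c01 pos[of "w \<xi>"] by (auto simp: w_def mult_left_le_one_le)
  finally have "(1 / l (w \<xi>)) * ((hessian f (z \<xi>) *v ((1 - c) *\<^sub>R (y - x))) \<bullet> sgn (grad f (z \<xi>)))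
      \<le> norm (y - x)"
    using pos[of "w \<xi>"] by (simp add: w_def pos_divide_le_eq mult.commute)
  moreover have "q l a (w c - a) = 0"
    using wc by (simp add: a_def)
  ultimately have "q l a (w 1 - a) \<le> norm (y - x)"
    using mean by linarith
  moreover have "q l a v < q l a (w 1 - a)"
    using q_strict_mono[of v "w 1 - a"] v w1 by (simp add: a_def)
  ultimately show False using dist by (simp add: a_def)
qed

text \<open>The mean value theorem on the segment from \<open>x\<close> to \<open>y\<close>, all of whose points satisfy the
  gradient bound.\<close>

lemma value_bound:
  assumes y: "y \<in> edomain f" and v: "0 \<le> v" and dist: "norm (y - x) \<le> q l (norm (grad f x)) v"
  shows "real_of_ereal (f y)
    \<le> real_of_ereal (f x) + (norm (grad f x) + v) * q l (norm (grad f x)) v"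
proof -
  define z where "z = (\<lambda>t. x + t *\<^sub>R (y - x))"
  have z_dom: "z t \<in> edomain f" if "t \<in> {0..1}" for t
    using segment_in_dom[OF y] that by (auto simp: z_def)
  have deriv: "((\<lambda>t. real_of_ereal (f (z t))) has_derivative (\<lambda>s. (s *\<^sub>R (y - x)) \<bullet> grad f (z t))) (at t)"
    if "t \<in> {0..1}" for t
  proof -
    have "(z has_derivative (\<lambda>s. s *\<^sub>R (y - x))) (at t)"
      unfolding z_def by (auto intro!: derivative_eq_intros)
    from has_derivative_compose[OF this f_derivative[OF z_dom[OF that]]] show ?thesis
      by (simp add: o_def)
  qed
  have cont_fz: "continuous_on {0..1} (\<lambda>t. real_of_ereal (f (z t)))"
    by (rule has_derivative_continuous_on, rule has_derivative_at_withinI, erule deriv)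
  obtain \<xi> where \<xi>: "0 < \<xi>" "\<xi> < 1"
    and mean: "real_of_ereal (f (z 1)) - real_of_ereal (f (z 0)) = ((1 - 0) *\<^sub>R (y - x)) \<bullet> grad f (z \<xi>)"
    by (rule mvt[OF zero_less_one cont_fz deriv]) auto
  have "norm (z \<xi> - x) \<le> norm (y - x)"
    using \<xi> by (simp add: z_def mult_left_le_one_le)
  then have "norm (grad f (z \<xi>)) \<le> norm (grad f x) + v"
    using \<xi> dist v by (intro grad_bound z_dom) auto
  then have "norm (y - x) * norm (grad f (z \<xi>)) \<le> q l (norm (grad f x)) v * (norm (grad f x) + v)"
    using dist v q_nonneg by (intro mult_mono) auto
  then show ?thesis
    using mean norm_cauchy_schwarz[of "y - x" "grad f (z \<xi>)"] by (simp add: z_def mult.commute)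
qed

text \<open>Since \<open>f\<close> is finite exactly on \<open>edomain f\<close>, the uniform bound on \<open>f\<close> together with continuity
  up to the closure makes \<open>edomain f\<close> relatively closed in the ball; it is also open, and the ball
  is connected.\<close>

lemma cball_subset_dom:
  assumes v: "0 \<le> v"
  shows "cball x (q l (norm (grad f x)) v) \<subseteq> edomain f"
proof -
  define B where "B = cball x (q l (norm (grad f x)) v)"
  define C where "C = real_of_ereal (f x) + (norm (grad f x) + v) * q l (norm (grad f x)) v"
  have "B \<inter> edomain f = B \<inter> (closure (edomain f) \<inter> f -` {..ereal C})"
  proof (intro equalityI subsetI)
    fix y assume y: "y \<in> B \<inter> edomain f"
    then have "real_of_ereal (f y) \<le> C"
      using v value_bound[of y v] by (auto simp: B_def C_def dist_norm norm_minus_commute)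
    then show "y \<in> B \<inter> (closure (edomain f) \<inter> f -` {..ereal C})"
      using y closure_subset[of "edomain f"] f_eq_ereal[of y] by (auto, metis ereal_less_eq(3))
  qed (auto simp: edomain_def intro: order.strict_trans1)
  moreover have "closed (closure (edomain f) \<inter> f -` {..ereal C})"
    using smooth by (intro continuous_closed_preimage) (auto simp: l_smooth_def)
  ultimately have "closedin (top_of_set B) (B \<inter> edomain f)"
    by (metis closedin_closed_Int)
  moreover have "openin (top_of_set B) (B \<inter> edomain f)"
    using open_dom by (rule openin_open_Int)
  moreover have "x \<in> B \<inter> edomain f"
    using x_dom q_nonneg[OF v] by (simp add: B_def)
  moreover have "connected B" unfolding B_def by simp
  ultimately have "B \<inter> edomain f = B"
    unfolding connected_clopen by blast
  then show ?thesis by (auto simp: B_def)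
qed

end

section \<open>The minimizer of the upper bound\<close>

theorem corollary4p6:
  fixes f :: "real^'d \<Rightarrow> ereal" and l :: "real \<Rightarrow> real" and x :: "real^'d"
  assumes not_MInf: "\<And>z. f z \<noteq> -\<infinity>"
    and open_dom: "open (edomain f)"
    and convex_dom: "convex (edomain f)"
    and smooth: "l_smooth l f"
    and x_dom: "x \<in> edomain f"
  shows "let g = grad f x;
             Q = (\<lambda>y. real_of_ereal (f x) + g \<bullet> (y - x)
                      + integral {0..norm (y - x)} (\<lambda>\<tau>. q_inv l (norm g) \<tau>));
             ystar = x - integral {0..1} (\<lambda>v. 1 / l (norm g + norm g * v)) *\<^sub>R g
         in ystar \<in> edomain f \<and>
            is_arg_min Q (\<lambda>y. y \<in> edomain f \<and> ennreal (norm (y - x)) < q_max l (norm g)) ystar \<and>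
            Q ystar = real_of_ereal (f x)
              - (norm g)\<^sup>2 * integral {0..1} (\<lambda>v. (1 - v) / l (norm g + norm g * v))"
proof -
  interpret l_smooth_at f l x
    using assms by unfold_locales
  define g where "g = grad f x"
  define a where "a = norm g"
  define Q where "Q = (\<lambda>y. real_of_ereal (f x) + g \<bullet> (y - x)
    + integral {0..norm (y - x)} (\<lambda>\<tau>. q_inv l a \<tau>))"
  define I where "I = integral {0..1} (\<lambda>v. 1 / l (a + a * v))"
  define ystar where "ystar = x - I *\<^sub>R g"
  have ag: "norm (grad f x) = a" by (simp add: a_def g_def)
  have aI: "a * I = q l a a"
    using q_at_a by (simp add: ag I_def)
  have "0 \<le> I"
    unfolding I_def
  proof (rule integral_nonneg)
    show "(\<lambda>v. 1 / l (a + a * v)) integrable_on {0..1}"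
      using nonneg unfolding ag
      by (intro integrable_continuous_real
          continuous_on_compose2[OF continuous_on_recip[unfolded ag], of _ "\<lambda>v. a * v"])
        (auto intro!: continuous_intros)
    show "0 \<le> 1 / l (a + a * v)" if "v \<in> {0..1}" for v
      using that nonneg recip_pos[of "a * v"] unfolding ag by (simp add: less_imp_le)
  qed
  then have dist_ystar: "norm (ystar - x) = q l a a"
    by (simp add: ystar_def a_def[symmetric] aI[symmetric] mult.commute)
  have dom: "ystar \<in> edomain f"
    using cball_subset_dom[OF nonneg] dist_ystar unfolding ag
    by (auto simp: dist_norm norm_minus_commute)
  have "g \<bullet> (ystar - x) = - (a * (a * I))"
    by (simp add: ystar_def a_def dot_square_norm power2_eq_square)
  then have Q_ystar: "Q ystar = real_of_ereal (f x)
      + (integral {0..q l a a} (q_inv l a) - a * q l a a)"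
    by (simp add: Q_def dist_ystar aI)
  have "Q ystar \<le> Q y" if near: "ennreal (norm (y - x)) < q_max l a" for y
  proof -
    obtain s where s: "0 \<le> s" "norm (y - x) = q l a s"
      by (rule less_q_max_imp_q[unfolded ag, OF norm_ge_zero near])
    \<comment> \<open>The only loss is here, and there is none at \<open>ystar\<close>, which lies along \<open>- g\<close>.\<close>
    have "- (a * norm (y - x)) \<le> g \<bullet> (y - x)"
      using Cauchy_Schwarz_ineq2[of g "y - x"] by (simp add: a_def)
    then show ?thesis
      using penalty_minimal[OF s(1)] unfolding Q_ystar ag by (simp add: Q_def s(2))
  qed
  moreover have "ennreal (norm (ystar - x)) < q_max l a"
    using q_less_q_max[of a] nonneg by (simp add: ag dist_ystar)
  ultimately have "is_arg_min Q (\<lambda>y. y \<in> edomain f \<and> ennreal (norm (y - x)) < q_max l a) ystar"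
    using dom by (auto simp: is_arg_min_def simp flip: not_le)
  moreover have "Q ystar = real_of_ereal (f x) - a\<^sup>2 * integral {0..1} (\<lambda>v. (1 - v) / l (a + a * v))"
    using penalty_at_a unfolding Q_ystar ag by simp
  ultimately show ?thesis
    using dom unfolding Let_def ystar_def I_def Q_def a_def g_def by blast
qed

end
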